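(* Let $p>0$, let $\mathbb{T}$ be a $p$-periodic time scale, $t_0\in\mathbb{T}$, let $M$ be a constant nonsingular $n\times n$ matrix, and let $$R(t):=\lim_{s\searrow\mu(t)}\frac{M^{s/p}-I}{s},\qquad t\in\mathbb{T},$$ with eigenvalues $\gamma_1(t),\dots,\gamma_n(t)$, repeated according to multiplicities. Then, for every positive integer $k$, $\gamma_1^k(t),\dots,\gamma_n^k(t)$ are the eigenvalues of $R^k(t)$, and the eigenvalues of $e_R(t,t_0)$ are $e_{\gamma_1}(t,t_0),\dots,e_{\gamma_n}(t,t_0)$.
   Context: A time scale $\mathbb{T}$ is a nonempty closed subset of $\mathbb{R}$; $\sigma(t)=\inf\{s\in\mathbb{T}:s>t\}$, $\mu(t)=\sigma(t)-t$, $f^\Delta$ is the delta (Hilger) derivative. $\mathbb{T}$ is $p$-periodic if for all $t\in\mathbb{T}$: $t+p\in\mathbb{T}$ and $\mu(t)=\mu(t+p)$; it is assumed that $0\le\mu(t)\le p$. $e_R(t,t_0)$ is the unique matrix solution of $X^\Delta=R(t)X$, $X(t_0)=I$, and for a scalar regressive function $\gamma$ (rd-continuous with $1+\mu\gamma\neq0$), $e_\gamma(t,t_0)$ is the unique solution of $y^\Delta=\gamma(t)y$, $y(t_0)=1$. Real power of a nonsingular $n\times n$ matrix $M$: let $\lambda_1,\dots,\lambda_k$ be the distinct eigenvalues with multiplicities $m_i$, $c(\lambda)=\prod_i(\lambda-\lambda_i)^{m_i}$ the characteristic polynomial, $a_i$ ($\deg a_i<m_i$) defined by $\frac1{c(\lambda)}=\sum_i\frac{a_i(\lambda)}{(\lambda-\lambda_i)^{m_i}}$,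 $b_i(\lambda)=\prod_{j\ne i}(\lambda-\lambda_j)^{m_j}$, $P_i(M)=a_i(M)b_i(M)$. Then for $r\in\mathbb{R}$, $M^r=\sum_{i=1}^kP_i(M)\lambda_i^r\left[\sum_{j=0}^{m_i-1}\binom rj\left(\frac{M-\lambda_iI}{\lambda_i}\right)^j\right]$ with principal values of $\lambda_i^r$, where $\binom rj=\frac{\Gamma(r+1)}{j!\,\Gamma(r-j+1)}$. The eigenvalue functions of $R$ are labelled consistently in $t$ as $\gamma_i(t)=\lim_{s\searrow\mu(t)}\frac{\lambda_i^{s/p}-1}{s}$, where $\lambda_1,\dots,\lambda_n$ are the eigenvalues of $M$ repeated according to multiplicity. *)

theory Defs
  imports "HOL-Analysis.Analysis" "HOL-Computational_Algebra.Computational_Algebra"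
begin

section \<open>Time scales\<close>

definition time_scale :: "real set \<Rightarrow> bool" where
  "time_scale T \<longleftrightarrow> T \<noteq> {} \<and> closed T"

text \<open>No convention for the infimum of the empty set is needed below: a \<open>p\<close>-periodic time scale with
  \<open>p > 0\<close> has no largest element.  For the same reason delta derivatives are considered at
  every point of the time scale.\<close>

definition forward_jump :: "real set \<Rightarrow> real \<Rightarrow> real" where
  "forward_jump T t = Inf {s \<in> T. s > t}"

definition graininess :: "real set \<Rightarrow> real \<Rightarrow> real" where
  "graininess T t = forward_jump T t - t"

definition periodic_time_scale :: "real \<Rightarrow> real set \<Rightarrow> bool" where
  "periodic_time_scale p T \<longleftrightarrow> time_scale T \<and>
     (\<forall>t\<in>T. t + p \<in> T \<and> graininess T t = graininess T (t + p) \<and>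
            0 \<le> graininess T t \<and> graininess T t \<le> p)"

definition has_delta_derivative ::
    "real set \<Rightarrow> (real \<Rightarrow> 'a::real_normed_vector) \<Rightarrow> 'a \<Rightarrow> real \<Rightarrow> bool" where
  "has_delta_derivative T f D t \<longleftrightarrow>
     (\<forall>\<epsilon>>0. \<exists>\<delta>>0. \<forall>s\<in>T. \<bar>s - t\<bar> < \<delta> \<longrightarrow>
        norm (f (forward_jump T t) - f s - (forward_jump T t - s) *\<^sub>R D)
          \<le> \<epsilon> * \<bar>forward_jump T t - s\<bar>)"

text \<open>Solutions are functions on the time scale only; \<^const>\<open>extensional\<close> fixes their values outside
  it, so that the unique solution on \<open>T\<close> can be picked by a definite description.\<close>

definition mat_delta_exp ::
    "real set \<Rightarrow> (real \<Rightarrow> complex^'n^'n) \<Rightarrow> real \<Rightarrow> real \<Rightarrow> complex^'n^'n" where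
  "mat_delta_exp T R t0 =
     (THE X. X \<in> extensional T \<and> X t0 = mat 1 \<and>
             (\<forall>t\<in>T. has_delta_derivative T X (R t ** X t) t))"

definition delta_exp :: "real set \<Rightarrow> (real \<Rightarrow> complex) \<Rightarrow> real \<Rightarrow> real \<Rightarrow> complex" where
  "delta_exp T g t0 =
     (THE y. y \<in> extensional T \<and> y t0 = 1 \<and>
             (\<forall>t\<in>T. has_delta_derivative T y (g t * y t) t))"

section \<open>Eigenvalues and matrix polynomials\<close>

definition mscale :: "'a::times \<Rightarrow> 'a^'n^'m \<Rightarrow> 'a^'n^'m"  (infixr \<open>*sm\<close> 75) where
  "c *sm A = map_matrix (\<lambda>x. c * x) A"

primrec matpow :: "'a::semiring_1^'n^'n \<Rightarrow> nat \<Rightarrow> 'a^'n^'n" where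
  "matpow A 0 = mat 1"
| "matpow A (Suc k) = A ** matpow A k"

definition mat_poly :: "'a::comm_ring_1 poly \<Rightarrow> 'a^'n^'n \<Rightarrow> 'a^'n^'n" where
  "mat_poly q A = (\<Sum>i\<le>degree q. coeff q i *sm matpow A i)"

definition charpoly :: "'a::comm_ring_1^'n^'n \<Rightarrow> 'a poly" where
  "charpoly A = det (mat [:0, 1:] - map_matrix (\<lambda>x. [:x:]) A)"

definition eigenvalues :: "complex^'n^'n \<Rightarrow> complex set" where
  "eigenvalues A = {z. \<exists>v. v \<noteq> 0 \<and> A *v v = z *s v}"

definition alg_mult :: "complex^'n^'n \<Rightarrow> complex \<Rightarrow> nat" where
  "alg_mult A z = order z (charpoly A)"

text \<open>The family \<open>l\<close> lists the eigenvalues of \<open>A\<close>, repeated according to multiplicity.\<close>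

definition eigenvalue_list :: "complex^'n^'n \<Rightarrow> ('n \<Rightarrow> complex) \<Rightarrow> bool" where
  "eigenvalue_list A l \<longleftrightarrow>
     range l = eigenvalues A \<and> (\<forall>z\<in>eigenvalues A. card {i. l i = z} = alg_mult A z)"

section \<open>Real powers of a nonsingular matrix\<close>

text \<open>The distinct eigenvalues \<open>z\<close> themselves serve as indices: \<open>pf_num M z\<close> is the numerator \<open>a\<^sub>i\<close>
  belonging to \<open>z = \<lambda>\<^sub>i\<close> in the partial fraction decomposition of \<open>1 / c\<close>, where \<open>c\<close> is the
  characteristic polynomial of \<open>M\<close>.  It is set to \<open>0\<close> at other indices.  Since the multiplicities
  are positive, the degree bound also covers the zero polynomial.\<close>

definition pf_num :: "complex^'n^'n \<Rightarrow> complex \<Rightarrow> complex poly" where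
  "pf_num M = (THE a.
     (\<forall>z. z \<notin> eigenvalues M \<longrightarrow> a z = 0) \<and>
     (\<forall>z\<in>eigenvalues M. degree (a z) < alg_mult M z) \<and>
     (\<forall>x. x \<notin> eigenvalues M \<longrightarrow>
        1 / poly (charpoly M) x =
          (\<Sum>z\<in>eigenvalues M. poly (a z) x / (x - z) ^ alg_mult M z)))"

definition pf_cofactor :: "complex^'n^'n \<Rightarrow> complex \<Rightarrow> complex poly" where
  "pf_cofactor M z = (\<Prod>w\<in>eigenvalues M - {z}. [:- w, 1:] ^ alg_mult M w)"

definition mat_proj :: "complex^'n^'n \<Rightarrow> complex \<Rightarrow> complex^'n^'n" where
  "mat_proj M z = mat_poly (pf_num M z) M ** mat_poly (pf_cofactor M z) M"

text \<open>\<open>r gchoose j\<close> agrees with \<open>\<Gamma>(r+1) / (j! \<Gamma>(r-j+1))\<close> unless \<open>r\<close> is a negative integer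
  (theorem \<open>gbinomial_Gamma\<close>), where it is the continuous extension of that quotient.
  The complex \<^const>\<open>powr\<close> is the principal value.\<close>

definition mat_rpow :: "complex^'n^'n \<Rightarrow> real \<Rightarrow> complex^'n^'n" where
  "mat_rpow M r =
     (\<Sum>z\<in>eigenvalues M.
        mat_proj M z **
        (z powr complex_of_real r *sm
         (\<Sum>j<alg_mult M z.
            complex_of_real (r gchoose j) *sm matpow ((1 / z) *sm (M - z *sm mat 1)) j)))"

section \<open>The generator of the matrix exponential and its eigenvalue functions\<close>

definition generator :: "real \<Rightarrow> real set \<Rightarrow> complex^'n^'n \<Rightarrow> real \<Rightarrow> complex^'n^'n" where
  "generator p T M t =
     Lim (at_right (graininess T t)) (\<lambda>s. (mat_rpow M (s / p) - mat 1) /\<^sub>R s)"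

definition eigenvalue_fun :: "real \<Rightarrow> real set \<Rightarrow> complex \<Rightarrow> real \<Rightarrow> complex" where
  "eigenvalue_fun p T z t =
     Lim (at_right (graininess T t))
       (\<lambda>s. (z powr complex_of_real (s / p) - 1) / complex_of_real s)"

end

theory Submission
  imports Defs "HOL-Number_Theory.Cong"
    "HOL-Computational_Algebra.Field_as_Ring"
begin

text \<open>By partial fractions \<open>M\<^sup>r\<close> is a polynomial in \<open>M\<close> which, modulo the factor of the characteristic
  polynomial belonging to an eigenvalue \<open>z\<close>, is the truncated binomial series of \<open>x\<^sup>r\<close> at \<open>z\<close>.
  With Cayley--Hamilton and Vandermonde's identity, \<open>r \<mapsto> M\<^sup>r\<close> is therefore a differentiable one-parameter group.
  Hence \<open>e\<^sub>R(t, t\<^sub>0) = M\<close> to the power \<open>(t - t\<^sub>0) / p\<close>, and likewise for the scalar equations.  So \<open>R(t)\<close>, its powers and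
  \<open>e\<^sub>R(t, t\<^sub>0)\<close> are all polynomials in \<open>M\<close>, and the claim is the spectral mapping theorem for polynomials,
  with multiplicities.\<close>

section \<open>Matrix polynomials and the spectral mapping theorem\<close>

no_notation fps_nth (infixl \<open>$\<close> 75)

text \<open>An eigenvector of \<open>M\<close> is also one of q(M), but this loses algebraic
  multiplicities. So \<open>eigenvalue_list\<close> is rephrased as a factorisation of the
  characteristic polynomial, and eigenvalues are matched by index: at each t, one polynomial must
  give the matrix when evaluated at \<open>M\<close> and the i-th scalar function when evaluated at
  \<open>lam i\<close>. This dictates two facts about real powers: the polynomial for M^r takes
  exactly the value z^r at each eigenvalue z, and the derivative at r = 0 comes from one polynomial
  \<open>Q\<close> that serves the matrix and the scalars alike. Both exponentials are definite
  descriptions, so uniqueness has to be proved too; an abstract group in a normed space covers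
  \<open>M\<close> and every \<open>lam i\<close> with one argument.\<close>

lemma matrix_diff_ldistrib: "A ** (B - C) = A ** B - A ** (C :: 'a::ring_1^'n^'m)"
  by (simp add: vec_eq_iff matrix_matrix_mult_def right_diff_distrib sum_subtractf)

lemma matrix_add_rdistrib: "(B + C) ** A = B ** A + C ** (A :: 'a::semiring_1^'n^'m)"
  by (simp add: vec_eq_iff matrix_matrix_mult_def distrib_right sum.distrib)

lemma mscale_nth [simp]: "(c *sm A) $ i $ j = c * A $ i $ j"
  by (simp add: mscale_def)

lemma mscale_add_left: "(a + b) *sm A = a *sm A + b *sm (A :: 'a::semiring^'n^'m)"
  by (simp add: vec_eq_iff distrib_right)

lemma mscale_mscale: "a *sm b *sm A = (a * b) *sm (A :: 'a::semigroup_mult^'n^'m)"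
  by (simp add: vec_eq_iff mult.assoc)

lemma mscale_zero_left [simp]: "0 *sm A = (0 :: 'a::semiring_0^'n^'m)"
  by (simp add: vec_eq_iff)

lemma mscale_one [simp]: "1 *sm A = (A :: 'a::monoid_mult^'n^'m)"
  by (simp add: vec_eq_iff)

lemma mscale_sum_right: "c *sm (\<Sum>i\<in>S. F i) = (\<Sum>i\<in>S. c *sm (F i :: 'a::semiring_0^'n^'m))"
  by (simp add: vec_eq_iff sum_distrib_left)

lemma mscale_mult_left: "(c *sm A) ** B = c *sm (A ** (B :: 'a::semiring_1^'n^'m))"
  by (simp add: vec_eq_iff matrix_matrix_mult_def sum_distrib_left mult.assoc)

lemma mscale_mult_right: "A ** (c *sm B) = c *sm (A ** (B :: 'a::comm_semiring_1^'n^'m))"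
  by (simp add: vec_eq_iff matrix_matrix_mult_def sum_distrib_left mult_ac)

lemma matrix_sum_mult_right: "A ** (\<Sum>i\<in>S. F i) = (\<Sum>i\<in>S. A ** (F i :: 'a::semiring_1^'n^'m))"
  by (induction S rule: infinite_finite_induct) (simp_all add: matrix_add_ldistrib)

section \<open>Evaluation of polynomials at a matrix\<close>

lemma mat_poly_eq_sum:
  assumes "degree q \<le> N"
  shows "mat_poly q A = (\<Sum>i\<le>N. coeff q i *sm matpow A i)"
  unfolding mat_poly_def
  by (rule sum.mono_neutral_left) (use assms in \<open>auto simp: coeff_eq_0\<close>)

lemma mat_poly_0 [simp]: "mat_poly 0 A = 0"
  by (simp add: mat_poly_def)

lemma mat_poly_add: "mat_poly (p + q) A = mat_poly p A + mat_poly q A"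
proof -
  define N where "N = max (degree p) (degree q)"
  have "degree (p + q) \<le> N" "degree p \<le> N" "degree q \<le> N"
    by (auto simp: N_def degree_add_le_max)
  then show ?thesis
    by (simp add: mat_poly_eq_sum mscale_add_left sum.distrib)
qed

lemma mat_poly_sum: "mat_poly (\<Sum>i\<in>S. f i) A = (\<Sum>i\<in>S. mat_poly (f i) A)"
  by (induction S rule: infinite_finite_induct) (simp_all add: mat_poly_add)

lemma mat_poly_smult: "mat_poly (smult c p) A = c *sm mat_poly p A"
  by (subst mat_poly_eq_sum[of _ "degree p"])
    (simp_all add: degree_smult_le mat_poly_def mscale_sum_right mscale_mscale)

lemma mat_poly_pCons: "mat_poly (pCons a p) A = a *sm mat 1 + A ** mat_poly p A"
  by (subst mat_poly_eq_sum[of _ "Suc (degree p)"])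
    (simp_all add: degree_pCons_le sum.atMost_Suc_shift matrix_sum_mult_right mscale_mult_right mat_poly_def
      del: sum.atMost_Suc)

lemma mat_poly_mult: "mat_poly (p * q) A = mat_poly p A ** mat_poly q A"
  by (induction p)
    (simp_all add: mat_poly_pCons mat_poly_add mat_poly_smult matrix_add_rdistrib mscale_mult_left
      matrix_mul_assoc)

lemma mat_poly_1 [simp]: "mat_poly 1 A = mat 1"
  by (simp add: mat_poly_def)

lemma mat_poly_diff: "mat_poly (p - q) A = mat_poly p A - mat_poly q A"
  using mat_poly_add[of "p - q" q A] by (simp add: algebra_simps)

lemma mat_poly_power: "mat_poly (p ^ k) A = matpow (mat_poly p A) k"
  by (induction k) (simp_all add: mat_poly_mult)

lemma mat_poly_linear: "mat_poly [:b, a:] A = a *sm A + b *sm mat 1"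
  by (simp add: mat_poly_pCons mscale_mult_right add.commute)

section \<open>Adjugate and Cayley-Hamilton theorem\<close>

text \<open>Entry (i, j) is the cofactor of \<open>A\<close> at (j, i), written with a unit vector
  in place of row j, so that no minors over a smaller index type occur. The ring is general because
  the adjugate is taken of a matrix of polynomials.\<close>

definition adjugate :: "'a::comm_ring_1^'n^'n \<Rightarrow> 'a^'n^'n" where
  "adjugate A = (\<chi> i j. det (\<chi> k. if k = j then axis i 1 else A $ k))"

text \<open>By linearity in row j, entry (i, j) of the product is the determinant of
  \<open>A\<close> with row j replaced by row i. Off the diagonal this matrix has two equal
  rows.\<close>

lemma mult_adjugate: "A ** adjugate A = det A *sm mat 1"
proof -
  have "(A ** adjugate A) $ i $ j = det A * mat 1 $ i $ j" for i j
  proof -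
    have "(A ** adjugate A) $ i $ j = (\<Sum>l\<in>UNIV. det (\<chi> k. if k = j then A $ i $ l *s axis l 1 else A $ k))"
      by (simp add: matrix_matrix_mult_def adjugate_def det_row_mul)
    also have "\<dots> = det (\<chi> k. if k = j then (\<Sum>l\<in>UNIV. A $ i $ l *s axis l 1) else A $ k)"
      using det_linear_row_sum[of UNIV j "\<lambda>_ l. A $ i $ l *s axis l 1" "\<lambda>k. A $ k"] by simp
    also have "(\<Sum>l\<in>UNIV. A $ i $ l *s axis l 1) = A $ i"
      by (simp add: vec_eq_iff axis_def if_distrib cong: if_cong)
    also have "det (\<chi> k. if k = j then A $ i else A $ k) = det A * mat 1 $ i $ j"
    proof (cases "i = j")
      case True
      then have "(\<chi> k. if k = j then A $ i else A $ k) = A"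
        by (simp add: vec_eq_iff)
      with True show ?thesis
        by (simp add: mat_def)
    next
      case False
      then have "det (\<chi> k. if k = j then A $ i else A $ k) = 0"
        by (intro det_identical_rows[of i j]) (auto simp: row_def vec_eq_iff)
      with False show ?thesis
        by (simp add: mat_def)
    qed
    finally show ?thesis .
  qed
  then show ?thesis
    by (simp add: vec_eq_iff)
qed

text \<open>Comparing coefficients in \<open>(x - A) adj (x - A) = c(x)\<close> expresses \<open>c(A)\<close> as a telescoping sum.\<close>

theorem Cayley_Hamilton: "mat_poly (charpoly A) A = (0 :: 'a::comm_ring_1^'n^'n)"
proof -
  define B where "B = mat [:0, 1:] - map_matrix (\<lambda>x. [:x:]) A"
  define c where "c = charpoly A"
  \<comment> \<open>\<open>N k\<close> is the matrix coefficient of x^k in the adjugate, and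
    \<open>N'\<close> is the same sequence for x times the adjugate, hence the shift by one with
    value 0 at the start.\<close>
  define N where "N k = map_matrix (\<lambda>q. coeff q k) (adjugate B)" for k
  define N' where "N' k = (case k of 0 \<Rightarrow> 0 | Suc l \<Rightarrow> N l)" for k
  have BN: "N' k - A ** N k = coeff c k *sm mat 1" for k
  proof -
    have "(N' k - A ** N k) $ i $ j = coeff ((B ** adjugate B) $ i $ j) k" for i j
    proof -
      have "B ** adjugate B = (\<chi> i j. [:0, 1:] * adjugate B $ i $ j) - map_matrix (\<lambda>x. [:x:]) A ** adjugate B"
        by (simp add: B_def vec_eq_iff matrix_matrix_mult_def left_diff_distrib sum_subtractf mat_def
            if_distrib[of "\<lambda>x. x * _"] cong: if_cong)
      then show ?thesis
        by (cases k) (simp_all add: N'_def N_def matrix_matrix_mult_def coeff_sum)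
    qed
    also have "coeff ((B ** adjugate B) $ i $ j) k = (coeff c k *sm mat 1) $ i $ j" for i j
      by (simp add: mult_adjugate c_def charpoly_def B_def mat_def)
    finally show ?thesis
      by (simp add: vec_eq_iff)
  qed
  \<comment> \<open>A common degree bound for c and all entries of the adjugate, so that the
    remainder of the telescoping sum vanishes at \<open>Suc K\<close>.\<close>
  define K where "K = Max (insert (degree c) {degree (adjugate B $ i $ j) | i j. True})"
  have fin: "finite {degree (adjugate B $ i $ j) | i j. True}"
    by (rule finite_subset[of _ "(\<lambda>(i, j). degree (adjugate B $ i $ j)) ` UNIV"]) auto
  have K: "degree c \<le> K" "degree (adjugate B $ i $ j) \<le> K" for i j
    using fin by (auto simp: K_def intro!: Max_ge)
  have matpow_Suc: "matpow A k ** A = A ** matpow A k" for k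
    by (induction k) (simp_all add: matrix_mul_assoc[symmetric])
  have sum_eq: "(\<Sum>i\<le>k. coeff c i *sm matpow A i) = - (matpow A (Suc k) ** N k)" for k
  proof (induction k)
    case 0
    have "coeff c 0 *sm mat 1 = - (A ** N 0)"
      using BN[of 0] by (simp add: N'_def)
    then show ?case
      by simp
  next
    case (Suc k)
    have "coeff c (Suc k) *sm matpow A (Suc k) = matpow A (Suc k) ** (coeff c (Suc k) *sm mat 1)"
      by (simp add: mscale_mult_right)
    also have "\<dots> = matpow A (Suc k) ** (N k - A ** N (Suc k))"
      using BN[of "Suc k"] by (simp add: N'_def)
    also have "\<dots> = matpow A (Suc k) ** N k - matpow A (Suc (Suc k)) ** N (Suc k)"
      by (simp only: matpow.simps(2)[of A "Suc k"] matpow_Suc[symmetric] matrix_mul_assoc matrix_diff_ldistrib)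
    finally show ?case
      using Suc.IH by simp
  qed
  have "mat_poly c A = - (matpow A (Suc (Suc K)) ** N (Suc K))"
    using K(1) by (subst mat_poly_eq_sum[OF le_SucI, OF K(1)]) (rule sum_eq)
  also have "N (Suc K) = 0"
    using K(2) by (simp add: N_def vec_eq_iff coeff_eq_0 le_imp_less_Suc)
  finally show ?thesis
    by (simp add: c_def del: matpow.simps)
qed

section \<open>Characteristic polynomial and spectral mapping\<close>

lemma poly_det: "poly (det A) x = det (map_matrix (\<lambda>q. poly q x) A)"
  by (simp add: det_def poly_sum poly_prod)

lemma poly_charpoly: "poly (charpoly A) x = det (x *sm mat 1 - A)"
  unfolding charpoly_def poly_det
  by (rule arg_cong[of _ _ det]) (simp add: vec_eq_iff mat_def)

lemma eigenvalues_eq: "z \<in> eigenvalues A \<longleftrightarrow> poly (charpoly A) z = 0"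
proof -
  have "(z *sm mat 1 - A) *v v = z *s v - A *v v" for v
    by (simp add: matrix_vector_mult_diff_rdistrib)
      (simp add: vec_eq_iff matrix_vector_mult_def mat_def if_distrib if_distribR
        cong: if_cong)
  then have "z \<in> eigenvalues A \<longleftrightarrow> \<not> (\<forall>v. (z *sm mat 1 - A) *v v = 0 \<longrightarrow> v = 0)"
    unfolding eigenvalues_def by (auto; metis)
  then show ?thesis
    by (simp add: poly_charpoly invertible_det_nz flip: matrix_left_invertible_ker invertible_left_inverse)
qed

lemma det_mscale: "det (c *sm A) = c ^ CARD('n) * det (A :: 'a::comm_ring_1^'n^'n)"
proof -
  have "c *sm A = (c *sm mat 1) ** A"
    by (simp add: mscale_mult_left)
  moreover have "det (c *sm mat 1 :: 'a^'n^'n) = c ^ CARD('n)"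
    by (subst det_diagonal) (simp_all add: mat_def)
  ultimately show ?thesis
    by (simp add: det_mul)
qed

text \<open>An analytic substitute for being monic of degree n: the quotient is det(I - A/x), a
  continuous function of 1/x with value 1 at 0.\<close>

lemma charpoly_tendsto:
  "((\<lambda>x. poly (charpoly A) x / x ^ CARD('n)) \<longlongrightarrow> 1) at_infinity" for A :: "complex^'n^'n"
proof -
  have lim: "((\<lambda>x. det (mat 1 - inverse x *sm A)) \<longlongrightarrow> det (mat 1 - 0 *sm A)) at_infinity"
    unfolding det_def vector_minus_component mscale_nth by (intro tendsto_intros tendsto_inverse_0)
  have "det (mat 1 - inverse x *sm A) = poly (charpoly A) x / x ^ CARD('n)" if "x \<noteq> 0" for x
  proof -
    have "x *sm mat 1 - A = (x *sm mat 1) ** (mat 1 - inverse x *sm A)"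
      using that by (simp add: mscale_mult_left) (simp add: vec_eq_iff right_diff_distrib flip: mult.assoc)
    then show ?thesis
      using that by (simp add: poly_charpoly det_mul det_mscale)
  qed
  then have ev: "\<forall>\<^sub>F x in at_infinity. det (mat 1 - inverse x *sm A) = poly (charpoly A) x / x ^ CARD('n)"
    by (rule eventually_mono[OF eventually_not_equal_at_infinity[of 0]])
  with lim show ?thesis
    using Lim_transform_eventually by fastforce
qed

lemma order_prod_linear:
  "finite S \<Longrightarrow> order z (\<Prod>i\<in>S. [:- l i, 1:]) = card {i \<in> S. l i = (z :: 'a::idom)}"
proof (induction S rule: finite_induct)
  case (insert i S)
  have "{j \<in> insert i S. l j = z} = (if l i = z then insert i {j \<in> S. l j = z} else {j \<in> S. l j = z})"
    by auto
  moreover have "(\<Prod>i\<in>S. [:- l i, 1:]) \<noteq> 0"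
    using insert.hyps by simp
  ultimately show ?case
    using insert order_power_n_n[of z 1] by (auto simp: order_mult order_0I simp del: mult_pCons_left)
qed simp

text \<open>Roots and their orders determine a complex polynomial up to its leading coefficient.
  That coefficient is then read off from the growth at infinity by
  \<open>charpoly_tendsto\<close>.\<close>

lemma eigenvalue_list_iff:
  fixes A :: "complex^'n^'n"
  shows "eigenvalue_list A l \<longleftrightarrow> charpoly A = (\<Prod>i\<in>UNIV. [:- l i, 1:])"
proof
  define c d where "c = charpoly A" and "d = (\<Prod>i\<in>UNIV. [:- l i, 1:])"
  have roots_d: "poly d z = 0 \<longleftrightarrow> z \<in> range l" for z
    by (auto simp: d_def poly_prod)
  have order_d: "order z d = card {i. l i = z}" for z
    by (simp add: d_def order_prod_linear)
  {
    assume "charpoly A = (\<Prod>i\<in>UNIV. [:- l i, 1:])"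
    then have "c = d"
      by (simp add: c_def d_def)
    moreover have "z \<in> range l \<longleftrightarrow> z \<in> eigenvalues A" for z
      using \<open>c = d\<close> roots_d by (simp add: eigenvalues_eq flip: c_def)
    ultimately show "eigenvalue_list A l"
      using order_d by (auto simp: eigenvalue_list_def alg_mult_def simp flip: c_def)
  next
    assume l: "eigenvalue_list A l"
    have roots_eq: "poly c z = 0 \<longleftrightarrow> poly d z = 0" for z
      using l by (simp add: roots_d eigenvalue_list_def eigenvalues_eq flip: c_def)
    have "order z c = order z d" if "poly c z = 0" for z
      using l that by (auto simp: order_d eigenvalue_list_def eigenvalues_eq alg_mult_def simp flip: c_def)
    then have "(\<Prod>z | poly c z = 0. [:- z, 1:] ^ order z c) = (\<Prod>z | poly d z = 0. [:- z, 1:] ^ order z d)"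
      by (intro prod.cong) (auto simp: roots_eq)
    also have "\<dots> = d"
    proof -
      have "lead_coeff d = 1"
        by (simp add: d_def lead_coeff_prod)
      then show ?thesis
        using complex_poly_decompose[of d] by simp
    qed
    finally have cd: "c = smult (lead_coeff c) d"
      using complex_poly_decompose[of c] by simp
    have lim: "((\<lambda>x. lead_coeff c * (\<Prod>i\<in>UNIV. 1 - l i * inverse x)) \<longlongrightarrow> lead_coeff c * (\<Prod>i\<in>(UNIV::'n set). 1 - l i * 0)) at_infinity"
      by (intro tendsto_intros tendsto_inverse_0)
    have "lead_coeff c * (\<Prod>i\<in>UNIV. 1 - l i * inverse x) = poly c x / x ^ CARD('n)" if "x \<noteq> 0" for x
    proof -
      have "(\<Prod>i\<in>UNIV. 1 - l i * inverse x) = (\<Prod>i\<in>UNIV. (x - l i) / x)"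
        using that by (intro prod.cong) (auto simp: field_simps)
      also have "\<dots> = poly d x / x ^ CARD('n)"
        by (simp add: d_def poly_prod prod_dividef)
      finally show ?thesis
        by (subst cd) simp
    qed
    then have ev: "\<forall>\<^sub>F x in at_infinity. lead_coeff c * (\<Prod>i\<in>UNIV. 1 - l i * inverse x) = poly c x / x ^ CARD('n)"
      by (rule eventually_mono[OF eventually_not_equal_at_infinity[of 0]])
    with lim have "((\<lambda>x. poly c x / x ^ CARD('n)) \<longlongrightarrow> lead_coeff c) at_infinity"
      using Lim_transform_eventually by fastforce
    then have "lead_coeff c = 1"
      using charpoly_tendsto[of A] tendsto_unique[OF trivial_limit_at_infinity] by (auto simp: c_def)
    with cd have "c = d"
      by simp
    then show "charpoly A = (\<Prod>i\<in>UNIV. [:- l i, 1:])"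
      by (simp add: c_def d_def)
  }
qed

text \<open>Both sides are multiplicative in \<open>q\<close>, so by the fundamental theorem of algebra only
  linear \<open>q\<close> matter, where this is the factorisation of the characteristic polynomial.\<close>

lemma det_mat_poly:
  fixes A :: "complex^'n^'n"
  assumes "eigenvalue_list A l"
  shows "det (mat_poly q A) = (\<Prod>i\<in>UNIV. poly q (l i))"
proof -
  define P where "P q \<longleftrightarrow> det (mat_poly q A) = (\<Prod>i\<in>UNIV. poly q (l i))" for q
  have mult: "P (q * r)" if "P q" "P r" for q r
    using that by (simp add: P_def mat_poly_mult det_mul prod.distrib)
  have one: "P 1"
    by (simp add: P_def)
  have const: "P [:a:]" for a
    by (simp add: P_def mat_poly_pCons det_mscale)
  have linear: "P [:- z, 1:]" for z
  proof -
    have "mat_poly [:- z, 1:] A = -1 *sm (z *sm mat 1 - A)"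
      by (simp add: mat_poly_linear vec_eq_iff)
    then have "det (mat_poly [:- z, 1:] A) = (-1) ^ CARD('n) * poly (charpoly A) z"
      by (simp add: det_mscale poly_charpoly)
    also have "\<dots> = (\<Prod>i\<in>UNIV. poly [:- z, 1:] (l i))"
      using assms by (simp add: eigenvalue_list_iff poly_prod flip: prod_constant prod.distrib)
    finally show ?thesis
      by (simp add: P_def)
  qed
  have power: "P ([:- z, 1:] ^ k)" for z k
    by (induction k) (simp_all only: power_0 power_Suc one mult linear)
  have "P (\<Prod>z\<in>S. [:- z, 1:] ^ k z)" for S k
    by (induction S rule: infinite_finite_induct) (simp_all add: one mult power)
  then have "P ([:lead_coeff q:] * (\<Prod>z | poly q z = 0. [:- z, 1:] ^ order z q))"
    by (intro mult const)
  then show ?thesis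
    using complex_poly_decompose[of q] by (simp add: P_def)
qed

text \<open>For a scalar w, the matrix wI - q(A) is again a polynomial in \<open>A\<close>, so
  \<open>det_mat_poly\<close> computes the characteristic polynomial of q(A) at every w.\<close>

theorem eigenvalue_list_mat_poly:
  assumes "eigenvalue_list A l"
  shows "eigenvalue_list (mat_poly q A) (\<lambda>i. poly q (l i))"
proof -
  have "poly (charpoly (mat_poly q A)) w = poly (\<Prod>i\<in>UNIV. [:- poly q (l i), 1:]) w" for w
  proof -
    have "w *sm mat 1 - mat_poly q A = mat_poly ([:w:] - q) A"
      by (simp add: mat_poly_diff mat_poly_pCons)
    then show ?thesis
      using assms by (simp add: poly_charpoly det_mat_poly poly_prod)
  qed
  then show ?thesis
    by (simp add: eigenvalue_list_iff poly_eq_poly_eq_iff[symmetric] fun_eq_iff)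
qed

section \<open>Partial fractions\<close>

lemma coprime_linear_powers:
  assumes "z \<noteq> w"
  shows "coprime ([:- z, 1:] ^ j) ([:- w, 1:] ^ k :: complex poly)"
proof -
  have "coprime [:- z, 1:] [:- w, 1:]"
  proof (rule coprimeI)
    fix d assume "d dvd [:- z, 1:]" "d dvd [:- w, 1:]"
    then have "d dvd [:- z, 1:] - [:- w, 1:]"
      by (rule dvd_diff)
    then have "d dvd [:w - z:]"
      by simp
    moreover have "[:w - z:] dvd 1"
      using assms by (simp add: is_unit_const_poly_iff dvd_field_iff)
    ultimately show "d dvd 1"
      by (rule dvd_trans)
  qed
  then show ?thesis
    by simp
qed

text \<open>Take for \<open>a z\<close> the inverse of the cofactor modulo its own factor, reduced
  to small degree. The sum is then 1 modulo each factor, hence modulo their product, and its degree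
  is too small for it to differ from 1.\<close>

lemma partial_fractions_exist:
  fixes S :: "complex set"
  assumes "finite S" "S \<noteq> {}" and m: "\<And>z. z \<in> S \<Longrightarrow> m z > 0"
  shows "\<exists>a. (\<forall>z. z \<notin> S \<longrightarrow> a z = 0) \<and> (\<forall>z\<in>S. degree (a z) < m z) \<and>
    (\<Sum>z\<in>S. a z * (\<Prod>w\<in>S - {z}. [:- w, 1:] ^ m w)) = 1"
proof -
  define L where "L z = [:- z, 1:] ^ m z" for z
  define b where "b z = (\<Prod>w\<in>S - {z}. L w)" for z
  have degL: "degree (L z) = m z" for z
    by (simp add: L_def degree_power_eq)
  have L0: "L z \<noteq> 0" for z
    by (simp add: L_def)
  have "\<exists>a. degree a < m z \<and> [a * b z = 1] (mod L z)" if "z \<in> S" for z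
  proof -
    have "coprime (b z) (L z)"
      unfolding b_def L_def by (intro prod_coprime_left coprime_linear_powers) auto
    then obtain u v where "u * b z + v * L z = 1"
      by (metis bezout_coefficients_fst_snd coprime_imp_gcd_eq_1)
    then have "[u * b z = 1] (mod L z)"
      by (metis cong_iff_dvd_diff add_diff_cancel_left' cong_sym dvd_triv_right)
    then have "[(u mod L z) * b z = 1] (mod L z)"
      by (simp add: cong_def mod_mult_left_eq)
    moreover have "degree (u mod L z) < m z"
      using degree_mod_less'[of "L z" u] L0 m[OF that] by (cases "u mod L z = 0") (auto simp: degL)
    ultimately show ?thesis
      by blast
  qed
  then obtain a0 where a0: "\<And>z. z \<in> S \<Longrightarrow> degree (a0 z) < m z"
      "\<And>z. z \<in> S \<Longrightarrow> [a0 z * b z = 1] (mod L z)"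
    by metis
  define a where "a z = (if z \<in> S then a0 z else 0)" for z
  have "[(\<Sum>z\<in>S. a z * b z) = 1] (mod L w)" if "w \<in> S" for w
  proof -
    have "[a z * b z = (if z = w then 1 else 0)] (mod L w)" if "z \<in> S" for z
    proof (cases "z = w")
      case False
      then have "L w dvd b z"
        using \<open>w \<in> S\<close> assms(1) by (auto simp: b_def)
      with False show ?thesis
        by (auto simp: cong_0_iff)
    qed (use a0(2) that in \<open>auto simp: a_def\<close>)
    then have "[(\<Sum>z\<in>S. a z * b z) = (\<Sum>z\<in>S. if z = w then 1 else 0)] (mod L w)"
      by (rule cong_sum)
    then show ?thesis
      using that assms(1) by simp
  qed
  then have "[(\<Sum>z\<in>S. a z * b z) = 1] (mod (\<Prod>w\<in>S. L w))"
    by (intro cong_cong_prod_coprime) (auto simp: L_def simp del: coprime_power_left_iff coprime_power_right_iff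
        intro!: coprime_linear_powers)
  then have dvd: "(\<Prod>w\<in>S. L w) dvd (\<Sum>z\<in>S. a z * b z) - 1"
    by (simp add: cong_iff_dvd_diff)
  have deg: "degree (\<Prod>w\<in>S. L w) = (\<Sum>w\<in>S. m w)"
    by (subst degree_prod_eq_sum_degree) (auto simp: degL L0)
  have "degree (a z * b z) < (\<Sum>w\<in>S. m w)" if "z \<in> S" for z
  proof -
    have "degree (a z * b z) \<le> degree (a z) + degree (b z)"
      by (rule degree_mult_le)
    also have "degree (b z) = (\<Sum>w\<in>S - {z}. m w)"
      unfolding b_def by (subst degree_prod_eq_sum_degree) (auto simp: degL L0)
    also have "degree (a z) + (\<Sum>w\<in>S - {z}. m w) < (\<Sum>w\<in>S. m w)"
      using a0(1) that assms(1) by (simp add: a_def sum.remove)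
    finally show ?thesis .
  qed
  moreover have "0 < (\<Sum>w\<in>S. m w)"
    using assms by (simp add: sum_pos)
  ultimately have "degree ((\<Sum>z\<in>S. a z * b z) - 1) < (\<Sum>w\<in>S. m w)"
    by (intro degree_diff_less degree_sum_less) auto
  then have "(\<Sum>z\<in>S. a z * b z) - 1 = 0"
    using dvd_imp_degree_le[OF dvd] deg by fastforce
  then show ?thesis
    using a0(1) by (intro exI[of _ a]) (auto simp: a_def b_def L_def)
qed

text \<open>All the other cofactors contain the factor of w. So each product of numerator and
  cofactor is 1 modulo its own factor and 0 modulo the others.\<close>

lemma partial_fraction_cong:
  fixes S :: "complex set"
  assumes "finite S" "w \<in> S" and "(\<Sum>z\<in>S. a z * (\<Prod>w\<in>S - {z}. [:- w, 1:] ^ m w)) = 1"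
  shows "[a w * (\<Prod>w\<in>S - {w}. [:- w, 1:] ^ m w) = 1] (mod [:- w, 1:] ^ m w)"
proof -
  define b where "b z = (\<Prod>w\<in>S - {z}. [:- w, 1:] ^ m w)" for z
  have "[(\<Sum>z\<in>S - {w}. a z * b z) = (\<Sum>z\<in>S - {w}. 0)] (mod [:- w, 1:] ^ m w)"
  proof (rule cong_sum)
    fix z assume "z \<in> S - {w}"
    then have "[:- w, 1:] ^ m w dvd b z"
      using assms(1,2) by (auto simp: b_def)
    then show "[a z * b z = 0] (mod [:- w, 1:] ^ m w)"
      by (simp add: cong_0_iff)
  qed
  then have "[a w * b w + (\<Sum>z\<in>S - {w}. a z * b z) = a w * b w + 0] (mod [:- w, 1:] ^ m w)"
    by (intro cong_add) simp_all
  then show ?thesis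
    using assms by (simp add: b_def sum.remove cong_sym)
qed

text \<open>The numerator is an inverse of the cofactor modulo the factor of w, and the degree bound
  selects one representative of its residue class.\<close>

lemma partial_fractions_unique:
  fixes S :: "complex set"
  assumes "finite S" "w \<in> S"
    and "(\<Sum>z\<in>S. a z * (\<Prod>w\<in>S - {z}. [:- w, 1:] ^ m w)) = 1" "degree (a w) < m w"
    and "(\<Sum>z\<in>S. a' z * (\<Prod>w\<in>S - {z}. [:- w, 1:] ^ m w)) = 1" "degree (a' w) < m w"
  shows "a w = a' w"
proof -
  define L where "L = [:- w, 1:] ^ m w"
  define b where "b = (\<Prod>w\<in>S - {w}. [:- w, 1:] ^ m w)"
  have "coprime b L"
    unfolding b_def L_def by (intro prod_coprime_left coprime_linear_powers) auto
  have "[a w * b = a' w * b] (mod L)"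
    unfolding b_def L_def
    by (rule cong_trans[OF partial_fraction_cong[OF assms(1-3)]
          cong_sym[OF partial_fraction_cong[OF assms(1,2,5)]]])
  then have "[a w = a' w] (mod L)"
    using \<open>coprime b L\<close> by (simp only: cong_mult_rcancel)
  then have "L dvd a w - a' w"
    by (simp add: cong_iff_dvd_diff)
  moreover have "degree (a w - a' w) < degree L"
    using assms by (simp add: L_def degree_power_eq degree_diff_less)
  ultimately show ?thesis
    using dvd_imp_degree_le[of L "a w - a' w"] by (cases "a w - a' w = 0") auto
qed

section \<open>Real powers of a nonsingular matrix\<close>

text \<open>Here \<open>[:-1, 1 / z:]\<close> is (x - z)/z, so this is z^r (1 + (x - z)/z)^r
  expanded at z and cut off below order m.\<close>

definition truncated_powr :: "complex \<Rightarrow> nat \<Rightarrow> real \<Rightarrow> complex poly" where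
  "truncated_powr z m r =
     smult (z powr of_real r) (\<Sum>j<m. smult (of_real (r gchoose j)) ([:-1, 1 / z:] ^ j))"

text \<open>The binomial series of exponents \<open>r\<close> and \<open>s\<close> multiply by Vandermonde's identity.\<close>

lemma truncated_powr_mult:
  assumes "z \<noteq> 0"
  shows "[truncated_powr z m r * truncated_powr z m s = truncated_powr z m (r + s)] (mod [:- z, 1:] ^ m)"
proof -
  define y :: "complex poly" where "y = [:-1, 1 / z:]"
  \<comment> \<open>The binomial series in a free variable. Modulo its m-th power the product is a
    comparison of coefficients; substituting \<open>y\<close>, a multiple of x - z, then carries the
    congruence over.\<close>
  define \<beta> :: "real \<Rightarrow> complex poly" where "\<beta> r = (\<Sum>j<m. monom (of_real (r gchoose j)) j)" for r
  have pcompose_monom: "pcompose (monom c j) y = smult c (y ^ j)" for c j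
    by (induction j) (simp_all add: monom_0 monom_Suc pcompose_pCons)
  have trunc: "truncated_powr z m r = smult (z powr of_real r) (pcompose (\<beta> r) y)" for r
    by (simp add: truncated_powr_def \<beta>_def pcompose_sum pcompose_monom flip: y_def)
  have coeff_\<beta>: "coeff (\<beta> r) k = (if k < m then of_real (r gchoose k) else 0)" for r k
    by (simp add: \<beta>_def coeff_sum)
  have "monom 1 m dvd \<beta> r * \<beta> s - \<beta> (r + s)"
  proof (unfold monom_1_dvd_iff', intro allI impI)
    fix k assume "k < m"
    then have "coeff (\<beta> r * \<beta> s) k = of_real (\<Sum>i\<le>k. (r gchoose i) * (s gchoose (k - i)))"
      by (auto simp: coeff_mult coeff_\<beta> intro!: sum.cong)
    also have "\<dots> = coeff (\<beta> (r + s)) k"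
      using gbinomial_Vandermonde[of r s k] \<open>k < m\<close> by (simp add: coeff_\<beta> atMost_atLeast0)
    finally show "coeff (\<beta> r * \<beta> s - \<beta> (r + s)) k = 0"
      by simp
  qed
  then obtain q where q: "\<beta> r * \<beta> s = \<beta> (r + s) + monom 1 m * q"
    by (metis dvdE diff_eq_eq add.commute)
  have "pcompose (\<beta> r) y * pcompose (\<beta> s) y = pcompose (\<beta> (r + s)) y + y ^ m * pcompose q y"
    using arg_cong[OF q, of "\<lambda>p. pcompose p y"] by (simp add: pcompose_mult pcompose_add pcompose_monom)
  moreover have "[:- z, 1:] ^ m dvd y ^ m"
  proof (rule dvd_power_same)
    have "y = smult (1 / z) [:- z, 1:]"
      using assms by (simp add: y_def)
    then show "[:- z, 1:] dvd y"
      by (simp only: dvd_smult dvd_refl)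
  qed
  ultimately have "[pcompose (\<beta> r) y * pcompose (\<beta> s) y = pcompose (\<beta> (r + s)) y] (mod [:- z, 1:] ^ m)"
    by (simp add: cong_iff_dvd_diff)
  then have "[[:z powr of_real r * z powr of_real s:] * (pcompose (\<beta> r) y * pcompose (\<beta> s) y) =
      [:z powr of_real (r + s):] * pcompose (\<beta> (r + s)) y] (mod [:- z, 1:] ^ m)"
    by (intro cong_mult) (simp_all add: powr_add)
  then show ?thesis
    by (simp add: trunc mult_ac)
qed

lemma poly_truncated_powr:
  assumes "z \<noteq> 0" "m > 0"
  shows "poly (truncated_powr z m r) z = z powr of_real r"
proof -
  have "(\<Sum>j<m. of_real (r gchoose j) * 0 ^ j) = (1 :: complex)"
    using assms(2) by (subst sum.remove[of _ 0]) auto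
  then show ?thesis
    using assms(1) by (simp add: truncated_powr_def poly_sum)
qed

lemma bounded_linear_mscale: "bounded_linear (\<lambda>c. c *sm (A :: complex^'n^'m))"
  unfolding linear_conv_bounded_linear[symmetric]
  by (rule linearI) (simp_all add: vec_eq_iff distrib_right)

lemma bounded_bilinear_matrix_mult: "bounded_bilinear ((**) :: complex^'n^'m \<Rightarrow> complex^'k^'n \<Rightarrow> complex^'k^'m)"
  unfolding bilinear_conv_bounded_bilinear[symmetric]
  by (auto simp: bilinear_def vec_eq_iff matrix_matrix_mult_def distrib_left distrib_right sum.distrib
      scaleR_sum_right intro!: linearI)

text \<open>The Chinese remainder solution for the local expansions: each weight
  \<open>pf_num M z * pf_cofactor M z\<close> is 1 modulo the factor of z and 0 modulo the
  others.\<close>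

definition rpow_poly :: "complex^'n^'n \<Rightarrow> real \<Rightarrow> complex poly" where
  "rpow_poly M r =
     (\<Sum>z\<in>eigenvalues M. pf_num M z * pf_cofactor M z * truncated_powr z (alg_mult M z) r)"

section \<open>The group of real powers of a fixed matrix\<close>

context
  fixes M :: "complex^'n^'n" and l :: "'n \<Rightarrow> complex"
  assumes l: "eigenvalue_list M l" and inv: "invertible M"
begin

lemma finite_eigenvalues: "finite (eigenvalues M)" and eigenvalues_nonempty: "eigenvalues M \<noteq> {}"
  using l unfolding eigenvalue_list_def by (metis finite finite_imageI, blast)

lemma eigenvalues_nonzero: "z \<in> eigenvalues M \<Longrightarrow> z \<noteq> 0"
  using det_mscale[of "-1" M] inv
  by (auto simp: eigenvalues_eq poly_charpoly invertible_det_nz mscale_def map_matrix_def minus_vec_def uminus_vec_def)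

lemma charpoly_nonzero: "charpoly M \<noteq> 0"
  using l by (simp add: eigenvalue_list_iff)

lemma alg_mult_pos: "z \<in> eigenvalues M \<Longrightarrow> alg_mult M z > 0"
  using charpoly_nonzero by (simp add: alg_mult_def eigenvalues_eq order_root)

lemma charpoly_eq_prod: "charpoly M = (\<Prod>z\<in>eigenvalues M. [:- z, 1:] ^ alg_mult M z)"
proof -
  have "lead_coeff (charpoly M) = 1"
    using l by (simp add: eigenvalue_list_iff lead_coeff_prod)
  moreover have "eigenvalues M = {z. poly (charpoly M) z = 0}"
    by (auto simp: eigenvalues_eq)
  ultimately show ?thesis
    using complex_poly_decompose[of "charpoly M"] by (simp add: alg_mult_def)
qed

lemma charpoly_eq_cofactor:
  "z \<in> eigenvalues M \<Longrightarrow> charpoly M = [:- z, 1:] ^ alg_mult M z * pf_cofactor M z"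
  using finite_eigenvalues by (simp only: charpoly_eq_prod pf_cofactor_def prod.remove)

text \<open>Clearing denominators turns the condition in \<open>pf_num\<close> into a polynomial
  identity. It is given only away from the finitely many poles, but that leaves infinitely many
  points.\<close>

lemma partial_fraction_iff:
  "(\<forall>x. x \<notin> eigenvalues M \<longrightarrow>
      1 / poly (charpoly M) x = (\<Sum>z\<in>eigenvalues M. poly (a z) x / (x - z) ^ alg_mult M z)) \<longleftrightarrow>
    (\<Sum>z\<in>eigenvalues M. a z * pf_cofactor M z) = 1"
proof -
  define s where "s = (\<Sum>z\<in>eigenvalues M. a z * pf_cofactor M z)"
  have eq: "1 / poly (charpoly M) x = (\<Sum>z\<in>eigenvalues M. poly (a z) x / (x - z) ^ alg_mult M z) \<longleftrightarrow> poly s x = 1"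
    if x: "x \<notin> eigenvalues M" for x
  proof -
    have c0: "poly (charpoly M) x \<noteq> 0"
      using x by (simp add: eigenvalues_eq)
    have "poly (a z) x / (x - z) ^ alg_mult M z = poly (a z * pf_cofactor M z) x / poly (charpoly M) x"
      if "z \<in> eigenvalues M" for z
      using c0 unfolding charpoly_eq_cofactor[OF that] by (simp add: poly_power field_simps)
    then have "(\<Sum>z\<in>eigenvalues M. poly (a z) x / (x - z) ^ alg_mult M z) = poly s x / poly (charpoly M) x"
      by (simp add: s_def poly_sum sum_divide_distrib)
    with c0 show ?thesis
      by auto
  qed
  have "s = 1" if "\<And>x. x \<notin> eigenvalues M \<Longrightarrow> poly s x = 1"
  proof (rule ccontr)
    assume "s \<noteq> 1"
    then have "finite {x. poly (s - 1) x = 0}"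
      by (intro poly_roots_finite) simp
    moreover have "- eigenvalues M \<subseteq> {x. poly (s - 1) x = 0}"
      using that by auto
    ultimately have "finite (UNIV :: complex set)"
      using finite_eigenvalues by (metis finite_compl finite_subset)
    then show False
      by (simp add: infinite_UNIV_char_0)
  qed
  with eq show ?thesis
    unfolding s_def[symmetric] by auto
qed

text \<open>Shows that the definite description in \<open>pf_num\<close> is proper. Its requirement
  of value 0 off the spectrum makes the whole function unique, not only its values at
  eigenvalues.\<close>

lemma pf_num_sum: "(\<Sum>z\<in>eigenvalues M. pf_num M z * pf_cofactor M z) = 1"
proof -
  have "\<exists>!a. (\<forall>z. z \<notin> eigenvalues M \<longrightarrow> a z = 0) \<and>
      (\<forall>z\<in>eigenvalues M. degree (a z) < alg_mult M z) \<and>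
      (\<Sum>z\<in>eigenvalues M. a z * pf_cofactor M z) = 1"
  proof (rule ex_ex1I)
    show "\<exists>a. (\<forall>z. z \<notin> eigenvalues M \<longrightarrow> a z = 0) \<and>
        (\<forall>z\<in>eigenvalues M. degree (a z) < alg_mult M z) \<and>
        (\<Sum>z\<in>eigenvalues M. a z * pf_cofactor M z) = 1"
      unfolding pf_cofactor_def
      by (rule partial_fractions_exist[OF finite_eigenvalues eigenvalues_nonempty alg_mult_pos])
  next
    fix a a'
    assume a: "(\<forall>z. z \<notin> eigenvalues M \<longrightarrow> a z = 0) \<and> (\<forall>z\<in>eigenvalues M. degree (a z) < alg_mult M z) \<and>
        (\<Sum>z\<in>eigenvalues M. a z * pf_cofactor M z) = 1"
      and a': "(\<forall>z. z \<notin> eigenvalues M \<longrightarrow> a' z = 0) \<and> (\<forall>z\<in>eigenvalues M. degree (a' z) < alg_mult M z) \<and>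
        (\<Sum>z\<in>eigenvalues M. a' z * pf_cofactor M z) = 1"
    show "a = a'"
    proof
      fix z
      show "a z = a' z"
      proof (cases "z \<in> eigenvalues M")
        case True
        then show ?thesis
          using a a' unfolding pf_cofactor_def
          by (intro partial_fractions_unique[OF finite_eigenvalues True]) auto
      qed (use a a' in auto)
    qed
  qed
  from theI'[OF this] show ?thesis
    unfolding pf_num_def partial_fraction_iff by blast
qed

lemma rpow_poly_cong:
  assumes "w \<in> eigenvalues M"
  shows "[rpow_poly M r = truncated_powr w (alg_mult M w) r] (mod [:- w, 1:] ^ alg_mult M w)"
proof -
  have "[pf_num M z * pf_cofactor M z * truncated_powr z (alg_mult M z) r =
      (if z = w then truncated_powr w (alg_mult M w) r else 0)] (mod [:- w, 1:] ^ alg_mult M w)"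
    if "z \<in> eigenvalues M" for z
  proof (cases "z = w")
    case True
    have "[pf_num M w * pf_cofactor M w = 1] (mod [:- w, 1:] ^ alg_mult M w)"
      using partial_fraction_cong[OF finite_eigenvalues assms] pf_num_sum unfolding pf_cofactor_def by blast
    from cong_mult[OF this cong_refl] True show ?thesis
      by simp
  next
    case False
    then have "[:- w, 1:] ^ alg_mult M w dvd pf_cofactor M z"
      using assms finite_eigenvalues by (auto simp: pf_cofactor_def)
    with False show ?thesis
      by (auto simp: cong_0_iff)
  qed
  then have "[rpow_poly M r = (\<Sum>z\<in>eigenvalues M. if z = w then truncated_powr w (alg_mult M w) r else 0)]
      (mod [:- w, 1:] ^ alg_mult M w)"
    unfolding rpow_poly_def by (rule cong_sum)
  then show ?thesis
    using assms finite_eigenvalues by simp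
qed

text \<open>The factors are pairwise coprime, so the difference is a multiple of the characteristic
  polynomial, which vanishes at \<open>M\<close>. Identities between powers of \<open>M\<close> can
  thus be checked at one eigenvalue at a time.\<close>

lemma mat_poly_cong:
  assumes "\<And>w. w \<in> eigenvalues M \<Longrightarrow> [p = q] (mod [:- w, 1:] ^ alg_mult M w)"
  shows "mat_poly p M = mat_poly q M"
proof -
  have "[p = q] (mod (\<Prod>w\<in>eigenvalues M. [:- w, 1:] ^ alg_mult M w))"
    using assms coprime_linear_powers by (intro cong_cong_prod_coprime) blast+
  then obtain k where "p - q = charpoly M * k"
    by (auto simp: cong_iff_dvd_diff dvd_def charpoly_eq_prod)
  then have "mat_poly (p - q) M = 0"
    by (simp add: mat_poly_mult Cayley_Hamilton)
  then show ?thesis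
    by (simp add: mat_poly_diff)
qed

lemma mat_rpow_eq: "mat_rpow M r = mat_poly (rpow_poly M r) M"
proof -
  have "matpow ((1 / z) *sm (M - z *sm mat 1)) j = mat_poly ([:-1, 1 / z:] ^ j) M"
    if "z \<in> eigenvalues M" for z j
  proof -
    have "(1 / z) *sm (M - z *sm mat 1) = mat_poly [:-1, 1 / z:] M"
      using eigenvalues_nonzero[OF that] by (simp add: mat_poly_linear vec_eq_iff field_simps)
    then show ?thesis
      by (simp add: mat_poly_power)
  qed
  then show ?thesis
    by (simp add: mat_rpow_def rpow_poly_def mat_poly_sum mat_poly_mult mat_poly_smult mat_proj_def
        mscale_mult_right truncated_powr_def)
qed

lemma mat_rpow_add: "mat_rpow M (r + s) = mat_rpow M r ** mat_rpow M s"
proof -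
  have "[rpow_poly M (r + s) = rpow_poly M r * rpow_poly M s] (mod [:- w, 1:] ^ alg_mult M w)"
    if "w \<in> eigenvalues M" for w
  proof -
    have "[rpow_poly M r * rpow_poly M s = truncated_powr w (alg_mult M w) (r + s)] (mod [:- w, 1:] ^ alg_mult M w)"
      using cong_trans[OF cong_mult[OF rpow_poly_cong rpow_poly_cong] truncated_powr_mult] that eigenvalues_nonzero
      by blast
    from cong_trans[OF rpow_poly_cong[OF that] cong_sym[OF this]] show ?thesis .
  qed
  then have "mat_poly (rpow_poly M (r + s)) M = mat_poly (rpow_poly M r * rpow_poly M s) M"
    by (rule mat_poly_cong)
  then show ?thesis
    by (simp add: mat_rpow_eq mat_poly_mult)
qed

lemma mat_rpow_0: "mat_rpow M 0 = mat 1"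
proof -
  have "truncated_powr z (alg_mult M z) 0 = 1" if "z \<in> eigenvalues M" for z
    using alg_mult_pos[OF that] eigenvalues_nonzero[OF that]
    by (simp add: truncated_powr_def gbinomial_0_left sum.remove[of _ 0])
  then have "rpow_poly M 0 = 1"
    using pf_num_sum by (simp add: rpow_poly_def)
  then show ?thesis
    by (simp add: mat_rpow_eq)
qed

lemma poly_rpow_poly:
  assumes "w \<in> eigenvalues M"
  shows "poly (rpow_poly M r) w = w powr of_real r"
proof -
  have "[:- w, 1:] dvd [:- w, 1:] ^ alg_mult M w"
    using alg_mult_pos[OF assms] by (simp add: dvd_power)
  then have "[:- w, 1:] dvd rpow_poly M r - truncated_powr w (alg_mult M w) r"
    using rpow_poly_cong[OF assms, of r] unfolding cong_iff_dvd_diff by (rule dvd_trans)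
  then have "poly (rpow_poly M r) w = poly (truncated_powr w (alg_mult M w) r) w"
    by (simp add: poly_eq_0_iff_dvd[symmetric])
  then show ?thesis
    using assms by (simp add: poly_truncated_powr eigenvalues_nonzero alg_mult_pos)
qed

text \<open>The exponent r enters \<open>rpow_poly\<close> only through scalar coefficients of fixed
  polynomials. Differentiating these coefficients gives \<open>Q\<close>, and evaluation at
  \<open>M\<close> or at z commutes with that.\<close>

lemma rpow_poly_derivative:
  obtains Q where "((\<lambda>r. mat_rpow M r) has_vector_derivative mat_poly Q M) (at 0)"
    and "\<And>z. z \<in> eigenvalues M \<Longrightarrow> ((\<lambda>r. z powr of_real r) has_vector_derivative poly Q z) (at 0)"
proof -
  \<comment> \<open>The coefficients are extended to complex exponents, where the rules for field
    derivatives apply, and restricted to the real line in \<open>D'\<close>.\<close>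
  define c where "c z j r = z powr r * (r gchoose j)" for z r :: complex and j
  define B where "B z j = pf_num M z * pf_cofactor M z * [:-1, 1 / z:] ^ j" for z j
  have rpow_poly: "rpow_poly M r = (\<Sum>z\<in>eigenvalues M. \<Sum>j<alg_mult M z. smult (c z j (of_real r)) (B z j))" for r
  proof -
    have "complex_of_real (r gchoose j) = of_real r gchoose j" for j
      by (simp add: gbinomial_prod_rev)
    moreover have "smult a (sum f A) = (\<Sum>j\<in>A. smult a (f j))" 
      for a :: complex and f and A :: "nat set"
      by (induction A rule: infinite_finite_induct) (simp_all add: smult_add_right)
    ultimately show ?thesis
      by (simp add: rpow_poly_def truncated_powr_def c_def B_def sum_distrib_left mult.assoc)
  qed
  have "c z j field_differentiable (at 0)" if "z \<in> eigenvalues M" for z j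
  proof -
    have "(\<lambda>w. \<Prod>i = 0..<j. w - complex_of_nat i) field_differentiable (at 0)"
      by (induction j) (auto intro!: derivative_intros)
    then show ?thesis
      unfolding c_def gbinomial_prod_rev divide_inverse using eigenvalues_nonzero[OF that]
      by (intro field_differentiable_mult field_differentiable_powr_right field_differentiable_const)
  qed
  then obtain D where D: "\<And>z j. z \<in> eigenvalues M \<Longrightarrow> (c z j has_field_derivative D z j) (at (of_real 0))"
    unfolding field_differentiable_def by (metis of_real_0)
  have D': "((\<lambda>r. c z j (of_real r)) has_vector_derivative D z j) (at 0)" if "z \<in> eigenvalues M" for z j
    using has_vector_derivative_real_field[OF D[OF that]] .
  define Q where "Q = (\<Sum>z\<in>eigenvalues M. \<Sum>j<alg_mult M z. smult (D z j) (B z j))"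
  have "((\<lambda>r. mat_rpow M r) has_vector_derivative mat_poly Q M) (at 0)"
    unfolding mat_rpow_eq rpow_poly Q_def mat_poly_sum mat_poly_smult
    by (intro has_vector_derivative_sum bounded_linear.has_vector_derivative[OF bounded_linear_mscale] D')
  moreover have "((\<lambda>r. z powr of_real r) has_vector_derivative poly Q z) (at 0)" if "z \<in> eigenvalues M" for z
    unfolding poly_rpow_poly[OF that, symmetric] unfolding rpow_poly Q_def poly_sum poly_smult
    by (intro has_vector_derivative_sum bounded_linear.has_vector_derivative[OF bounded_linear_mult_left] D')
  ultimately show ?thesis
    using that by blast
qed

end

section \<open>Delta derivatives on periodic time scales\<close>

lemma bdd_below_greater: "bdd_below {s \<in> T. s > (t :: real)}"
  by (rule bdd_belowI[of _ t]) auto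

lemma forward_jump_le: "s \<in> T \<Longrightarrow> t < s \<Longrightarrow> forward_jump T t \<le> s"
  unfolding forward_jump_def using bdd_below_greater by (intro cInf_lower) auto

lemma has_delta_derivative_cong:
  assumes "forward_jump T t \<in> T" "\<And>s. s \<in> T \<Longrightarrow> f s = g s"
  shows "has_delta_derivative T f D t \<longleftrightarrow> has_delta_derivative T g D t"
  using assms by (simp add: has_delta_derivative_def)

lemma has_delta_derivative_dense:
  assumes "forward_jump T t = t"
  shows "has_delta_derivative T f D t \<longleftrightarrow> (f has_vector_derivative D) (at t within T)"
proof -
  have "norm (f t - f s - (t - s) *\<^sub>R D) = norm (f s - f t - (s - t) *\<^sub>R D)" for s
    by (subst norm_minus_cancel[symmetric]) (simp add: algebra_simps)
  then show ?thesis
    unfolding has_delta_derivative_def has_vector_derivative_def has_derivative_within_alt assms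
    by (simp add: bounded_linear_scaleR_left abs_minus_commute)
qed

text \<open>Near t the distance from s to the forward jump is bounded and bounded away from 0. So
  the estimate says that the defect \<open>h\<close> is continuous at t and, taking s = t, that it
  vanishes there.\<close>

lemma has_delta_derivative_scattered:
  fixes f :: "real \<Rightarrow> 'a::real_normed_vector"
  assumes "t \<in> T" and less: "t < forward_jump T t"
  shows "has_delta_derivative T f D t \<longleftrightarrow>
    continuous (at t within T) f \<and> f (forward_jump T t) = f t + graininess T t *\<^sub>R D"
proof -
  define \<sigma> where "\<sigma> = forward_jump T t"
  define h where "h s = f \<sigma> - f s - (\<sigma> - s) *\<^sub>R D" for s
  have delta: "has_delta_derivative T f D t \<longleftrightarrow>
      (\<forall>\<epsilon>>0. \<exists>\<delta>>0. \<forall>s\<in>T. \<bar>s - t\<bar> < \<delta> \<longrightarrow> norm (h s) \<le> \<epsilon> * \<bar>\<sigma> - s\<bar>)"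
    by (simp add: has_delta_derivative_def h_def \<sigma>_def)
  have h_eq: "h t = 0 \<longleftrightarrow> f \<sigma> = f t + graininess T t *\<^sub>R D"
    by (auto simp: h_def graininess_def \<sigma>_def algebra_simps)
  have f_eq: "f = (\<lambda>s. f \<sigma> - h s - (\<sigma> - s) *\<^sub>R D)"
    by (simp add: h_def)
  have cont_iff: "continuous (at t within T) f \<longleftrightarrow> continuous (at t within T) h"
  proof
    assume "continuous (at t within T) h"
    then show "continuous (at t within T) f"
      by (subst f_eq) (intro continuous_intros)
  qed (unfold h_def, intro continuous_intros)
  have "(\<forall>\<epsilon>>0. \<exists>\<delta>>0. \<forall>s\<in>T. \<bar>s - t\<bar> < \<delta> \<longrightarrow> norm (h s) \<le> \<epsilon> * \<bar>\<sigma> - s\<bar>) \<longleftrightarrow>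
      continuous (at t within T) h \<and> h t = 0" (is "?L \<longleftrightarrow> ?R")
  proof
    assume L: ?L
    have "norm (h t) \<le> \<epsilon> * (\<sigma> - t)" if "\<epsilon> > 0" for \<epsilon>
      using L that assms by (fastforce simp: \<sigma>_def)
    then have "norm (h t) / (\<sigma> - t) \<le> \<epsilon>" if "\<epsilon> > 0" for \<epsilon>
      using that less by (simp add: divide_le_eq \<sigma>_def)
    then have "norm (h t) / (\<sigma> - t) \<le> 0"
      by (rule field_le_epsilon) simp
    then have "h t = 0"
      using less by (simp add: divide_le_0_iff \<sigma>_def)
    moreover have "continuous (at t within T) h"
      unfolding continuous_within_eps_delta
    proof (intro allI impI)
      fix e :: real assume "e > 0"
      \<comment> \<open>For s within 1 of t the distance to the jump is at most \<sigma> - t + 1;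
        the factor 2 makes the final bound strict.\<close>
      define \<epsilon> where "\<epsilon> = e / (2 * (\<sigma> - t + 1))"
      have "\<epsilon> > 0"
        using \<open>e > 0\<close> less by (simp add: \<epsilon>_def \<sigma>_def)
      then obtain \<delta> where \<delta>: "\<delta> > 0" "\<And>s. s \<in> T \<Longrightarrow> \<bar>s - t\<bar> < \<delta> \<Longrightarrow> norm (h s) \<le> \<epsilon> * \<bar>\<sigma> - s\<bar>"
        using L by blast
      have "norm (h s) < e" if "s \<in> T" "\<bar>s - t\<bar> < min \<delta> 1" for s
      proof -
        have "norm (h s) \<le> \<epsilon> * \<bar>\<sigma> - s\<bar>"
          using \<delta>(2) that by simp
        also have "\<dots> \<le> \<epsilon> * (\<sigma> - t + 1)"
          using that \<open>\<epsilon> > 0\<close> less by (intro mult_left_mono) (auto simp: \<sigma>_def)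
        also have "\<dots> = e / 2"
          using less by (simp add: \<epsilon>_def \<sigma>_def field_simps)
        also have "\<dots> < e"
          using \<open>e > 0\<close> by simp
        finally show ?thesis .
      qed
      then show "\<exists>d>0. \<forall>x'\<in>T. dist x' t < d \<longrightarrow> dist (h x') (h t) < e"
        using \<delta>(1) \<open>h t = 0\<close> by (intro exI[of _ "min \<delta> 1"]) (auto simp: dist_norm)
    qed
    ultimately show ?R
      by simp
  next
    assume R: ?R
    show ?L
    proof (intro allI impI)
      fix \<epsilon> :: real assume "\<epsilon> > 0"
      \<comment> \<open>Within (\<sigma> - t)/2 of t, the distance to the jump is at least (\<sigma>
        - t)/2.\<close>
      define e where "e = \<epsilon> * ((\<sigma> - t) / 2)"
      have "e > 0"
        using \<open>\<epsilon> > 0\<close> less by (simp add: e_def \<sigma>_def)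
      then obtain d where d: "d > 0" "\<And>s. s \<in> T \<Longrightarrow> \<bar>s - t\<bar> < d \<Longrightarrow> norm (h s) < e"
        using R unfolding continuous_within_eps_delta by (auto simp: dist_norm)
      have "norm (h s) \<le> \<epsilon> * \<bar>\<sigma> - s\<bar>" if "s \<in> T" "\<bar>s - t\<bar> < min d ((\<sigma> - t) / 2)" for s
      proof -
        have "norm (h s) \<le> e"
          using d(2)[of s] that by simp
        also have "\<dots> \<le> \<epsilon> * \<bar>\<sigma> - s\<bar>"
          unfolding e_def using that \<open>\<epsilon> > 0\<close> by (intro mult_left_mono) (auto simp: abs_if split: if_splits)
        finally show ?thesis .
      qed
      then show "\<exists>\<delta>>0. \<forall>s\<in>T. \<bar>s - t\<bar> < \<delta> \<longrightarrow> norm (h s) \<le> \<epsilon> * \<bar>\<sigma> - s\<bar>"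
        using d(1) less by (intro exI[of _ "min d ((\<sigma> - t) / 2)"]) (auto simp: \<sigma>_def)
    qed
  qed
  then show ?thesis
    unfolding delta cont_iff using h_eq by (auto simp: \<sigma>_def)
qed

section \<open>Constancy from zero delta derivative\<close>

context
  fixes p :: real and T :: "real set"
  assumes p: "p > 0" and per: "periodic_time_scale p T"
begin

lemma closed_time_scale: "closed T"
  using per by (simp add: periodic_time_scale_def time_scale_def)

lemma points_above_nonempty: "t \<in> T \<Longrightarrow> {s \<in> T. s > t} \<noteq> {}"
  using per p by (force simp: periodic_time_scale_def)

lemma forward_jump_ge: "t \<in> T \<Longrightarrow> t \<le> forward_jump T t"
  unfolding forward_jump_def using points_above_nonempty by (intro cInf_greatest) auto

lemma forward_jump_in: 
  assumes "t \<in> T"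
  shows "forward_jump T t \<in> T"
proof -
  have "forward_jump T t \<in> closure {s \<in> T. s > t}"
    unfolding forward_jump_def using points_above_nonempty[OF assms] bdd_below_greater by (rule closure_contains_Inf)
  also have "\<dots> \<subseteq> T"
    using closed_time_scale by (intro closure_minimal) auto
  finally show ?thesis .
qed

text \<open>A continuous induction along \<open>T\<close>: the set of \<open>s\<close> up to which \<open>f\<close> moves with speed at most
  \<open>\<epsilon>\<close> is closed, and can be prolonged at right-scattered as well as at right-dense points.\<close>

lemma delta_derivative_zero_mono:
  fixes f :: "real \<Rightarrow> 'a::real_normed_vector"
  assumes deriv: "\<And>t. t \<in> T \<Longrightarrow> has_delta_derivative T f 0 t"
    and "a \<in> T" "b \<in> T" "a \<le> b" "\<epsilon> > 0"
  shows "norm (f b - f a) \<le> \<epsilon> * (b - a)"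
proof -
  have cont: "continuous_on T f"
    unfolding continuous_on_eq_continuous_within
  proof
    fix t assume "t \<in> T"
    show "continuous (at t within T) f"
    proof (cases "forward_jump T t = t")
      case True
      then show ?thesis
        using deriv[OF \<open>t \<in> T\<close>] by (simp add: has_delta_derivative_dense has_vector_derivative_continuous)
    next
      case False
      with \<open>t \<in> T\<close> forward_jump_ge[of t] show ?thesis
        using deriv[OF \<open>t \<in> T\<close>] has_delta_derivative_scattered[OF \<open>t \<in> T\<close>, of f 0] by force
    qed
  qed
  define G where "G s \<longleftrightarrow> norm (f s - f a) \<le> \<epsilon> * (s - a)" for s
  define S where "S = {t \<in> T \<inter> {a..b}. \<forall>s \<in> T \<inter> {a..t}. G s}"
  define c where "c = Sup S"
  have "continuous_on T (\<lambda>s. norm (f s - f a) - \<epsilon> * (s - a))"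
    using cont by (intro continuous_intros)
  then have "closed (T \<inter> (\<lambda>s. norm (f s - f a) - \<epsilon> * (s - a)) -` {..0})"
    using closed_time_scale by (intro continuous_closed_preimage) auto
  also have "T \<inter> (\<lambda>s. norm (f s - f a) - \<epsilon> * (s - a)) -` {..0} = {s \<in> T. G s}"
    by (auto simp: G_def)
  finally have closed_G: "closed {s \<in> T. G s}" .
  have aS: "a \<in> S"
    using assms by (auto simp: S_def G_def)
  have bdd: "bdd_above S"
    by (rule bdd_aboveI[of _ b]) (auto simp: S_def)
  have "c \<in> closure S"
    unfolding c_def using aS bdd by (intro closure_contains_Sup) auto
  also have "closure S \<subseteq> {s \<in> T. G s} \<inter> {a..b}"
    using closed_G by (intro closure_minimal) (auto simp: S_def)
  finally have c: "c \<in> T" "G c" "a \<le> c" "c \<le> b"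
    by auto
  have below: "G s" if "s \<in> T" "a \<le> s" "s \<le> c" for s
  proof (cases "s = c")
    case False
    then have "s < Sup S"
      using that by (simp add: c_def)
    then obtain t where "t \<in> S" "s < t"
      using aS by (metis empty_iff less_cSupD)
    then show ?thesis
      using that by (auto simp: S_def)
  qed (use c in simp)
  have "c = b"
  proof (rule ccontr)
    assume "c \<noteq> b"
    then have "c < b"
      using c by simp
    have "\<exists>d\<in>T. c < d \<and> d \<le> b \<and> (\<forall>s\<in>T. c < s \<and> s \<le> d \<longrightarrow> norm (f s - f c) \<le> \<epsilon> * (s - c))"
    proof (cases "forward_jump T c = c")
      case False
      then have less: "c < forward_jump T c"
        using forward_jump_ge[OF c(1)] by simp
      have "f (forward_jump T c) = f c"
        using deriv[OF c(1)] by (simp add: has_delta_derivative_scattered[OF c(1) less])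
      \<comment> \<open>No point of \<open>T\<close> lies strictly between c and its forward
        jump.\<close>
      then have "f s = f c" if "s \<in> T" "c < s" "s \<le> forward_jump T c" for s
        using forward_jump_le[of s T c] that by simp
      moreover have "forward_jump T c \<le> b"
        using forward_jump_le assms(3) \<open>c < b\<close> by blast
      ultimately show ?thesis
        using forward_jump_in[OF c(1)] less assms(5) by (intro bexI[of _ "forward_jump T c"]) simp_all
    next
      case True
      obtain \<delta> where \<delta>: "\<delta> > 0" "\<And>s. s \<in> T \<Longrightarrow> \<bar>s - c\<bar> < \<delta> \<Longrightarrow> norm (f c - f s) \<le> \<epsilon> * \<bar>c - s\<bar>"
        using deriv[OF c(1)] assms(5) unfolding has_delta_derivative_def True by auto
      \<comment> \<open>At a right-dense c, points of \<open>T\<close> accumulate from the right, so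
        one lies within reach of the derivative estimate and before b.\<close>
      have "Inf {s \<in> T. s > c} < min (c + \<delta>) b"
        using True \<delta>(1) \<open>c < b\<close> by (simp add: forward_jump_def)
      then obtain d where d: "d \<in> T" "c < d" "d < min (c + \<delta>) b"
        using cInf_lessD[OF points_above_nonempty[OF c(1)]] by blast
      then show ?thesis
        using \<delta>(2) by (intro bexI[of _ d]) (fastforce simp: norm_minus_commute)+
    qed
    then obtain d where d: "d \<in> T" "c < d" "d \<le> b"
        "\<And>s. s \<in> T \<Longrightarrow> c < s \<Longrightarrow> s \<le> d \<Longrightarrow> norm (f s - f c) \<le> \<epsilon> * (s - c)"
      by blast
    have "G s" if "s \<in> T" "a \<le> s" "s \<le> d" for s
    proof (cases "s \<le> c")
      case False
      then have "norm (f s - f c) + norm (f c - f a) \<le> \<epsilon> * (s - c) + \<epsilon> * (c - a)"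
        using d(4)[of s] that c(2) by (intro add_mono) (auto simp: G_def)
      moreover have "norm (f s - f a) \<le> norm (f s - f c) + norm (f c - f a)"
        using norm_triangle_ineq[of "f s - f c" "f c - f a"] by simp
      ultimately show ?thesis
        by (simp add: G_def algebra_simps)
    qed (use below that in simp)
    then have "d \<in> S"
      using d c by (auto simp: S_def)
    then have "d \<le> c"
      unfolding c_def using bdd by (rule cSup_upper)
    with \<open>c < d\<close> show False
      by simp
  qed
  with c show ?thesis
    by (simp add: G_def)
qed

lemma delta_derivative_zero_const:
  fixes f :: "real \<Rightarrow> 'a::real_normed_vector"
  assumes "\<And>t. t \<in> T \<Longrightarrow> has_delta_derivative T f 0 t" and "a \<in> T" "b \<in> T"
  shows "f a = f b"
proof -
  have "f a = f b" if "a \<in> T" "b \<in> T" "a \<le> b" for a b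
  proof -
    have "norm (f b - f a) \<le> 0 + e" if "e > 0" for e
    proof -
      \<comment> \<open>The summand 1 keeps the rate defined and positive also when a = b.\<close>
      have "norm (f b - f a) \<le> (e / (b - a + 1)) * (b - a)"
        using that \<open>a \<le> b\<close> by (intro delta_derivative_zero_mono assms \<open>a \<in> T\<close> \<open>b \<in> T\<close>) auto
      also have "\<dots> \<le> e"
        using that \<open>a \<le> b\<close> by (simp add: field_simps)
      finally show ?thesis
        by simp
    qed
    then have "norm (f b - f a) \<le> 0"
      by (rule field_le_epsilon)
    then show ?thesis
      by simp
  qed
  then show ?thesis
    using assms(2,3) by (metis linear)
qed

end

section \<open>One-parameter groups on time scales\<close>

text \<open>Evaluates both \<open>generator\<close> and \<open>eigenvalue_fun\<close>: a = 0 is the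
  right-dense case, a > 0 the right-scattered one, where the quotient is continuous at a.\<close>

lemma Lim_difference_quotient:
  fixes G :: "real \<Rightarrow> 'a::real_normed_vector"
  assumes deriv: "(G has_vector_derivative D) (at 0)" and cont: "isCont G a" and "a \<ge> 0"
  shows "Lim (at_right a) (\<lambda>s. (G s - G 0) /\<^sub>R s) = (if a = 0 then D else (G a - G 0) /\<^sub>R a)"
proof (rule tendsto_Lim)
  show "((\<lambda>s. (G s - G 0) /\<^sub>R s) \<longlongrightarrow> (if a = 0 then D else (G a - G 0) /\<^sub>R a)) (at_right a)"
  proof (cases "a = 0")
    case True
    have "((\<lambda>s. (1 / norm (s - 0)) *\<^sub>R (G s - (G 0 + (s - 0) *\<^sub>R D))) \<longlongrightarrow> 0) (at_right 0)"
      using has_vector_derivative_at_within[OF deriv, of "{0<..}"]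
      by (simp add: has_vector_derivative_def has_derivative_within)
    moreover have "\<forall>\<^sub>F s in at_right 0.
        (1 / norm (s - 0)) *\<^sub>R (G s - (G 0 + (s - 0) *\<^sub>R D)) = (G s - G 0) /\<^sub>R s - D"
      using eventually_at_right_less[of "0::real"]
      by eventually_elim (simp add: algebra_simps divide_inverse)
    ultimately have "((\<lambda>s. (G s - G 0) /\<^sub>R s - D) \<longlongrightarrow> 0) (at_right 0)"
      by (rule Lim_transform_eventually)
    with True show ?thesis
      by (simp add: LIM_zero_cancel)
  next
    case False
    have "(G \<longlongrightarrow> G a) (at_right a)"
      using cont by (simp add: isCont_def filterlim_at_split)
    with False show ?thesis
      by (auto intro!: tendsto_intros)
  qed
qed simp

text \<open>Multiplying an arbitrary solution with the inverse group leaves a function with zero delta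
  derivative, so uniqueness needs no Gronwall estimate and holds to the left of \<open>t\<^sub>0\<close> as well.\<close>

locale one_parameter_group = bounded_bilinear mult
  for mult :: "'a::real_normed_vector \<Rightarrow> 'a \<Rightarrow> 'a"  (infixl \<open>\<star>\<close> 70) +
  fixes G :: "real \<Rightarrow> 'a" and D :: 'a
  assumes assoc: "(a \<star> b) \<star> c = a \<star> (b \<star> c)"
    and unit: "G 0 \<star> a = a" "a \<star> G 0 = a"
    and group: "G (r + s) = G r \<star> G s"
    and deriv_0: "(G has_vector_derivative D) (at 0)"
begin

text \<open>Both orders of the product are recorded because the first serves the solution and the
  second its inverse; then \<open>D\<close> cancels in the product rule.\<close>

lemma derivative: "(G has_vector_derivative D \<star> G a) (at a)" "(G has_vector_derivative G a \<star> D) (at a)"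
proof -
  have shift: "((\<lambda>s. G (s - a)) has_vector_derivative D) (at a)"
  proof -
    have "((\<lambda>s. s - a) has_vector_derivative 1) (at a)"
      by (auto intro!: derivative_eq_intros)
    from vector_diff_chain_at[OF this] deriv_0 show ?thesis
      by (simp add: o_def)
  qed
  have "((\<lambda>s. G (s - a) \<star> G a) has_vector_derivative D \<star> G a) (at a)"
    by (rule bounded_linear.has_vector_derivative[OF bounded_linear_left shift])
  then show "(G has_vector_derivative D \<star> G a) (at a)"
    by (simp flip: group)
  have "((\<lambda>s. G a \<star> G (s - a)) has_vector_derivative G a \<star> D) (at a)"
    by (rule bounded_linear.has_vector_derivative[OF bounded_linear_right shift])
  then show "(G has_vector_derivative G a \<star> D) (at a)"
    by (simp flip: group)
qed

lemma isCont_G: "isCont G a"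
  using derivative(1) by (rule has_vector_derivative_continuous)

text \<open>At a right-scattered point, G(0) + \<mu> R = G(\<mu>), so the equation just says that
  stepping to the forward jump multiplies by G(\<mu>). As an equivalence, the lemma evaluates the
  definite descriptions of the exponentials by rewriting.\<close>

lemma delta_equation_unique_solution:
  assumes p: "p > 0" and per: "periodic_time_scale p T" and t0: "t0 \<in> T"
    and R: "\<And>t. t \<in> T \<Longrightarrow> R t = Lim (at_right (graininess T t)) (\<lambda>s. (G s - G 0) /\<^sub>R s)"
  shows "X \<in> extensional T \<and> X t0 = G 0 \<and> (\<forall>t\<in>T. has_delta_derivative T X (R t \<star> X t) t) \<longleftrightarrow>
    X = restrict (\<lambda>t. G (t - t0)) T"
proof -
  note scattered = has_delta_derivative_scattered
    and dense = has_delta_derivative_dense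
    and jump_ge = forward_jump_ge[OF p per] and jump_in = forward_jump_in[OF p per]
  have R_dense: "R t = D" if "t \<in> T" "forward_jump T t = t" for t
    using that Lim_difference_quotient[OF deriv_0 isCont_G, of 0] by (simp add: R graininess_def)
  have R_scattered: "y + graininess T t *\<^sub>R (R t \<star> y) = G (graininess T t) \<star> y"
    if "t \<in> T" "t < forward_jump T t" for t y
  proof -
    have "graininess T t *\<^sub>R R t = G (graininess T t) - G 0"
      using that Lim_difference_quotient[OF deriv_0 isCont_G, of "graininess T t"]
      by (simp add: R graininess_def)
    then have "graininess T t *\<^sub>R (R t \<star> y) = G (graininess T t) \<star> y - y"
      by (simp add: diff_left unit flip: scaleR_left)
    then show ?thesis
      by simp
  qed
  have cases: "forward_jump T t = t \<or> t < forward_jump T t" if "t \<in> T" for t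
    using jump_ge[OF that] by auto
  show ?thesis
  proof
    assume X: "X \<in> extensional T \<and> X t0 = G 0 \<and> (\<forall>t\<in>T. has_delta_derivative T X (R t \<star> X t) t)"
    \<comment> \<open>The inverse of the expected solution; the product of \<open>A\<close> and
      \<open>X\<close> will be constant.\<close>
    define A where "A t = G (t0 - t)" for t
    have A_deriv: "(A has_vector_derivative - (A t \<star> D)) (at t)" for t
    proof -
      have "((\<lambda>s. t0 - s) has_vector_derivative -1) (at t)"
        by (auto intro!: derivative_eq_intros)
      from vector_diff_chain_at[OF this derivative(2)] show ?thesis
        by (simp add: o_def A_def[abs_def])
    qed
    have "has_delta_derivative T (\<lambda>t. A t \<star> X t) 0 t" if t: "t \<in> T" for t
    proof -
      have deriv: "has_delta_derivative T X (R t \<star> X t) t"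
        using X t by blast
      show ?thesis
        using cases[OF t]
      proof
        assume eq: "forward_jump T t = t"
        have "(X has_vector_derivative D \<star> X t) (at t within T)"
          using deriv by (simp add: dense[OF eq] R_dense t eq)
        from has_vector_derivative[OF has_vector_derivative_at_within[OF A_deriv] this]
        have "((\<lambda>t. A t \<star> X t) has_vector_derivative 0) (at t within T)"
          by (simp add: assoc minus_left)
        then show ?thesis
          by (simp add: dense[OF eq])
      next
        assume less: "t < forward_jump T t"
        have "continuous (at t within T) X" and "X (forward_jump T t) = G (graininess T t) \<star> X t"
          using deriv t less by (auto simp: scattered R_scattered)
        moreover have "A (forward_jump T t) \<star> G (graininess T t) = A t"
          by (simp add: A_def graininess_def flip: group)
        moreover have "continuous (at t within T) A"
          using has_vector_derivative_continuous[OF A_deriv] by (rule continuous_at_imp_continuous_at_within)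
        ultimately show ?thesis
          by (auto simp: scattered[OF t less] intro!: continuous simp flip: assoc)
      qed
    qed
    then have "A t \<star> X t = A t0 \<star> X t0" if "t \<in> T" for t
      using that t0 by (intro delta_derivative_zero_const[OF p per])
    then have AX: "A t \<star> X t = G 0" if "t \<in> T" for t
      using X that by (simp add: A_def unit)
    have "X t = G (t - t0)" if "t \<in> T" for t
    proof -
      have "X t = G (t - t0) \<star> (A t \<star> X t)"
        by (simp add: A_def unit flip: assoc group)
      then show ?thesis
        using AX[OF that] by (simp add: unit)
    qed
    with X show "X = restrict (\<lambda>t. G (t - t0)) T"
      by (auto simp: extensional_def restrict_def)
  next
    assume X: "X = restrict (\<lambda>t. G (t - t0)) T"
    define B where "B t = G (t - t0)" for t
    have B_deriv: "(B has_vector_derivative D \<star> B t) (at t)" for t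
    proof -
      have "((\<lambda>s. s - t0) has_vector_derivative 1) (at t)"
        by (auto intro!: derivative_eq_intros)
      from vector_diff_chain_at[OF this derivative(1)] show ?thesis
        by (simp add: o_def B_def[abs_def])
    qed
    have "has_delta_derivative T B (R t \<star> B t) t" if t: "t \<in> T" for t
      using cases[OF t]
    proof
      assume eq: "forward_jump T t = t"
      then show ?thesis
        using has_vector_derivative_at_within[OF B_deriv] by (simp add: dense[OF eq] R_dense t)
    next
      assume less: "t < forward_jump T t"
      have "B (forward_jump T t) = G (graininess T t) \<star> B t"
        by (simp add: B_def graininess_def flip: group)
      moreover have "continuous (at t within T) B"
        using has_vector_derivative_continuous[OF B_deriv] by (rule continuous_at_imp_continuous_at_within)
      ultimately show ?thesis
        by (simp add: scattered[OF t less] R_scattered[OF t less])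
    qed
    then have "\<forall>t\<in>T. has_delta_derivative T X (R t \<star> X t) t"
      \<comment> \<open>\<open>X\<close> agrees with \<open>B\<close> only on \<open>T\<close>,
        which suffices because the forward jump stays in \<open>T\<close>.\<close>
      using has_delta_derivative_cong[OF jump_in, of _ X B] by (auto simp: X B_def)
    then show "X \<in> extensional T \<and> X t0 = G 0 \<and> (\<forall>t\<in>T. has_delta_derivative T X (R t \<star> X t) t)"
      using t0 by (simp add: X)
  qed
qed

end

lemma has_vector_derivative_divide_arg:
  assumes "(f has_vector_derivative D) (at 0)"
  shows "((\<lambda>s. f (s / p)) has_vector_derivative D /\<^sub>R p) (at (0 :: real))"
proof -
  have "((\<lambda>s. s / p) has_vector_derivative inverse p) (at 0)"
    by (auto intro!: derivative_eq_intros simp: divide_inverse)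
  from vector_diff_chain_at[OF this] assms show ?thesis
    by (simp add: o_def)
qed

lemma mscale_of_real: "of_real c *sm A = c *\<^sub>R (A :: complex^'n^'m)"
  by (simp add: vec_eq_iff del: mult_cancel_right) (simp add: scaleR_conv_of_real)

section \<open>Spectra of R, its powers and its exponential\<close>

theorem theorem5p3:
  fixes p t0 :: real and T :: "real set"
    and M :: "complex^'n^'n" and lam :: "'n \<Rightarrow> complex"
    and R :: "real \<Rightarrow> complex^'n^'n" and gam :: "'n \<Rightarrow> real \<Rightarrow> complex"
  assumes "p > 0" and "periodic_time_scale p T" and "t0 \<in> T"
    and "invertible M"
    and "eigenvalue_list M lam"
    and "\<And>t. t \<in> T \<Longrightarrow> R t = generator p T M t"
    and "\<And>i t. t \<in> T \<Longrightarrow> gam i t = eigenvalue_fun p T (lam i) t"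
  shows "(\<forall>k\<ge>1. \<forall>t\<in>T. eigenvalue_list (matpow (R t) k) (\<lambda>i. gam i t ^ k)) \<and>
         (\<forall>t\<in>T. eigenvalue_list (mat_delta_exp T R t0 t) (\<lambda>i. delta_exp T (gam i) t0 t))"
proof -
  note M = assms(5,4)
  have lam: "lam i \<in> eigenvalues M" for i
    using assms(5) by (auto simp: eigenvalue_list_def)
  obtain Q where Q: "((\<lambda>r. mat_rpow M r) has_vector_derivative mat_poly Q M) (at 0)"
      "\<And>z. z \<in> eigenvalues M \<Longrightarrow> ((\<lambda>r. z powr of_real r) has_vector_derivative poly Q z) (at 0)"
    using rpow_poly_derivative[OF M] by blast
  define G where "G s = mat_rpow M (s / p)" for s
  define g where "g i s = lam i powr of_real (s / p)" for i and s :: real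
  have G_0: "G 0 = mat 1" and g_0: "g i 0 = 1" for i
    using eigenvalues_nonzero[OF M lam] by (simp_all add: G_def g_def mat_rpow_0[OF M])
  interpret G: one_parameter_group "(**)" G "mat_poly Q M /\<^sub>R p"
    unfolding one_parameter_group_def one_parameter_group_axioms_def
    using has_vector_derivative_divide_arg[OF Q(1)] mat_rpow_add[OF M]
    by (auto simp: bounded_bilinear_matrix_mult matrix_mul_assoc G_0)
      (simp_all add: G_def[abs_def] add_divide_distrib)
  have g: "one_parameter_group (*) (g i) (poly Q (lam i) /\<^sub>R p)" for i
    unfolding one_parameter_group_def one_parameter_group_axioms_def
    using has_vector_derivative_divide_arg[OF Q(2)[OF lam[of i]], of p]
    by (auto simp: bounded_bilinear_mult mult.assoc g_0)
      (simp_all add: g_def[abs_def] add_divide_distrib powr_add)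
  have R: "R t = Lim (at_right (graininess T t)) (\<lambda>s. (G s - G 0) /\<^sub>R s)" if "t \<in> T" for t
    using that by (simp add: assms(6) generator_def G_0) (simp add: G_def)
  have gam: "gam i t = Lim (at_right (graininess T t)) (\<lambda>s. (g i s - g i 0) /\<^sub>R s)" if "t \<in> T" for i t
    using that by (simp add: assms(7) eigenvalue_fun_def g_0 scaleR_conv_of_real field_simps) (simp add: g_def)
  have "eigenvalue_list (matpow (R t) k) (\<lambda>i. gam i t ^ k)" if t: "t \<in> T" for t k
  proof -
    define a where "a = graininess T t"
    have "a \<ge> 0"
      using forward_jump_ge[OF assms(1,2) t] by (simp add: a_def graininess_def)
    \<comment> \<open>The common polynomial for R(t) and all \<open>gam i t\<close>. The factor 1/p
      in the dense case is the inner derivative of s/p; the scattered case is the difference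
      quotient (M^(a/p) - I)/a.\<close>
    define L where "L = (if a = 0 then smult (of_real (inverse p)) Q
      else smult (of_real (inverse a)) (rpow_poly M (a / p) - 1))"
    have "R t = mat_poly L M"
      using Lim_difference_quotient[OF G.deriv_0 G.isCont_G \<open>a \<ge> 0\<close>] R[OF t]
      by (simp add: L_def mat_poly_smult mat_poly_diff mscale_of_real G_0 del: of_real_inverse flip: a_def)
        (simp add: G_def mat_rpow_eq[OF M])
    moreover have "gam i t = poly L (lam i)" for i
      using Lim_difference_quotient[OF one_parameter_group.deriv_0[OF g]
          one_parameter_group.isCont_G[OF g] \<open>a \<ge> 0\<close>] gam[OF t, of i]
      by (simp add: L_def poly_rpow_poly[OF M lam] g_0 scaleR_conv_of_real flip: a_def)
        (simp add: g_def)
    ultimately show ?thesis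
      using eigenvalue_list_mat_poly[OF assms(5), of "L ^ k"] by (simp add: mat_poly_power poly_power)
  qed
  moreover have "eigenvalue_list (mat_delta_exp T R t0 t) (\<lambda>i. delta_exp T (gam i) t0 t)" if t: "t \<in> T" for t
  proof -
    define r where "r = (t - t0) / p"
    have "mat_delta_exp T R t0 = restrict (\<lambda>t. G (t - t0)) T"
      unfolding mat_delta_exp_def G_0[symmetric]
      by (subst G.delta_equation_unique_solution[OF assms(1-3) R]) simp_all
    then have "mat_delta_exp T R t0 t = mat_poly (rpow_poly M r) M"
      using t by (simp add: G_def mat_rpow_eq[OF M] r_def)
    \<comment> \<open>The same polynomial as for the matrix exponential, since the scalar solution
      is \<open>lam i\<close> to the power r.\<close>
    moreover have "delta_exp T (gam i) t0 t = poly (rpow_poly M r) (lam i)" for i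
    proof -
      have "delta_exp T (gam i) t0 = restrict (\<lambda>t. g i (t - t0)) T"
        unfolding delta_exp_def g_0[of i, symmetric]
        by (subst one_parameter_group.delta_equation_unique_solution[OF g assms(1-3) gam]) simp_all
      then show ?thesis
        using t by (simp add: g_def poly_rpow_poly[OF M lam] r_def)
    qed
    ultimately show ?thesis
      using eigenvalue_list_mat_poly[OF assms(5), of "rpow_poly M r"] by simp
  qed
  ultimately show ?thesis
    by blast
qed

end
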